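(* Let $(L,\tau)$ and $(M,\tau')$ be two locally solid Riesz spaces and let $T:L\to M$ be a positive homogeneous (linear) operator. If there exists a $\tau$-neighborhood $V$ of zero in $L$ such that $T(V)$ is an order bounded subset of $M$, then $T$ is topologically continuous.
   Context: A Riesz space is a real ordered vector space that is a lattice. A subset $Y$ of a Riesz space is solid if $|x|\le|y|$ and $y\in Y$ imply $x\in Y$. A locally solid Riesz space is a Riesz space with a vector topology (not assumed Hausdorff) having a neighborhood base at zero consisting of solid sets. A subset is order bounded if it is contained in some order interval $[u,v]=\{x:u\le x\le v\}$. A linear operator $T:L\to M$ is called positive homogeneous if $T(\lambda x)=\lambda T(x)$ for all $x\in L$ and $\lambda>0$ (automatic for linear $T$), and topologically continuous if $T^{-1}(O)\in\tau$ for every $O\in\tau'$. *)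

theory Defs
  imports "HOL-Analysis.Analysis" "HOL-Library.Lattice_Algebras"
begin

text \<open>The modulus is the library's \<open>\<bar>x\<bar>\<close>, which the class \<open>lattice_ab_group_add_abs\<close> requires to
  equal \<open>sup x (- x)\<close>.\<close>

class riesz_space = ordered_real_vector + lattice_ab_group_add_abs

instance real :: riesz_space ..

definition solid :: "'a::riesz_space set \<Rightarrow> bool" where
  "solid Y \<longleftrightarrow> (\<forall>x y. \<bar>x\<bar> \<le> \<bar>y\<bar> \<and> y \<in> Y \<longrightarrow> x \<in> Y)"

definition order_bounded :: "'a::order set \<Rightarrow> bool" where
  "order_bounded A \<longleftrightarrow> (\<exists>u v. A \<subseteq> {u..v})"

text \<open>Topologies are explicit objects rather than type class instances: the vector topologies
  considered here need not be Hausdorff, nor be tied to a norm.\<close>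

definition vector_topology :: "'a::real_vector topology \<Rightarrow> bool" where
  "vector_topology \<tau> \<longleftrightarrow>
     topspace \<tau> = UNIV \<and>
     continuous_map (prod_topology \<tau> \<tau>) \<tau> (\<lambda>(x, y). x + y) \<and>
     continuous_map (prod_topology euclideanreal \<tau>) \<tau> (\<lambda>(c, x). c *\<^sub>R x)"

text \<open>Neighborhoods are not required to be open.\<close>

definition neighborhood_of_zero :: "'a::zero topology \<Rightarrow> 'a set \<Rightarrow> bool" where
  "neighborhood_of_zero \<tau> V \<longleftrightarrow> (\<exists>U. openin \<tau> U \<and> 0 \<in> U \<and> U \<subseteq> V)"

definition locally_solid :: "'a::riesz_space topology \<Rightarrow> bool" where
  "locally_solid \<tau> \<longleftrightarrow>
     vector_topology \<tau> \<and>
     (\<exists>\<B>. (\<forall>U\<in>\<B>. neighborhood_of_zero \<tau> U \<and> solid U) \<and>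
          (\<forall>N. neighborhood_of_zero \<tau> N \<longrightarrow> (\<exists>U\<in>\<B>. U \<subseteq> N)))"

definition positive_homogeneous :: "('a::real_vector \<Rightarrow> 'b::real_vector) \<Rightarrow> bool" where
  "positive_homogeneous T \<longleftrightarrow> (\<forall>x. \<forall>c>0. T (c *\<^sub>R x) = c *\<^sub>R T x)"

end

theory Submission
  imports Defs
begin

text \<open>If \<open>\<bar>T x\<bar> \<le> w\<close> on \<open>V\<close> and \<open>U\<close> is a solid neighborhood of zero in \<open>M\<close>, then \<open>U\<close> contains
  \<open>e *\<^sub>R w\<close> for some \<open>e > 0\<close> because it is absorbing, and solidity puts \<open>T ` (e V)\<close> inside \<open>U\<close>.
  So \<open>T\<close> is continuous at zero, hence everywhere by translation.\<close>

lemma continuous_map_translation: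
  assumes "vector_topology \<tau>"
  shows "continuous_map \<tau> \<tau> (\<lambda>x. a + x)"
proof -
  have pair: "continuous_map \<tau> (prod_topology \<tau> \<tau>) (\<lambda>x. (a, x))"
    using assms by (intro continuous_map_pairedI) (auto simp: vector_topology_def)
  have op: "continuous_map (prod_topology \<tau> \<tau>) \<tau> (\<lambda>(x, y). x + y)"
    using assms by (simp add: vector_topology_def)
  show ?thesis
    using continuous_map_compose[OF pair op] by (simp add: o_def)
qed

lemma continuous_map_scaleR_right:
  assumes "vector_topology \<tau>"
  shows "continuous_map \<tau> \<tau> (\<lambda>x. c *\<^sub>R x)"
proof -
  have pair: "continuous_map \<tau> (prod_topology euclideanreal \<tau>) (\<lambda>x. (c, x))"
    by (intro continuous_map_pairedI) auto
  have op: "continuous_map (prod_topology euclideanreal \<tau>) \<tau> (\<lambda>(c, x). c *\<^sub>R x)"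
    using assms by (simp add: vector_topology_def)
  show ?thesis
    using continuous_map_compose[OF pair op] by (simp add: o_def)
qed

text \<open>Here the vector is fixed and the scalar varies: continuity along the line through
  \<open>x\<close> is what makes neighborhoods of zero absorbing.\<close>

lemma continuous_map_scaleR_left:
  assumes "vector_topology \<tau>"
  shows "continuous_map euclideanreal \<tau> (\<lambda>c. c *\<^sub>R x)"
proof -
  have pair: "continuous_map euclideanreal (prod_topology euclideanreal \<tau>) (\<lambda>c. (c, x))"
    using assms by (intro continuous_map_pairedI) (auto simp: vector_topology_def)
  have op: "continuous_map (prod_topology euclideanreal \<tau>) \<tau> (\<lambda>(c, x). c *\<^sub>R x)"
    using assms by (simp add: vector_topology_def)
  show ?thesis
    using continuous_map_compose[OF pair op] by (simp add: o_def)
qed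

lemma neighborhood_of_zero_vimage:
  assumes "continuous_map \<tau> \<tau>' f" "topspace \<tau> = UNIV" "f 0 = 0" "neighborhood_of_zero \<tau>' N"
  shows "neighborhood_of_zero \<tau> (f -` N)"
proof -
  obtain U where U: "openin \<tau>' U" "0 \<in> U" "U \<subseteq> N"
    using assms(4) by (auto simp: neighborhood_of_zero_def)
  have "openin \<tau> (f -` U)"
    using openin_continuous_map_preimage[OF assms(1) U(1)] assms(2) by (simp add: vimage_def)
  with U assms(3) show ?thesis
    unfolding neighborhood_of_zero_def by (intro exI[of _ "f -` U"]) auto
qed

text \<open>The scalars \<open>c\<close> with \<open>c *\<^sub>R x \<in> N\<close> form a
  neighborhood of 0 in the reals, so some of them are positive.\<close>

lemma neighborhood_of_zero_absorbs:
  assumes "vector_topology \<tau>" "neighborhood_of_zero \<tau> N"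
  obtains e where "e > 0" "e *\<^sub>R x \<in> N"
proof -
  have "neighborhood_of_zero euclideanreal ((\<lambda>c. c *\<^sub>R x) -` N)"
    using neighborhood_of_zero_vimage[OF continuous_map_scaleR_left] assms by simp
  then obtain S where S: "open S" "0 \<in> S" "S \<subseteq> (\<lambda>c. c *\<^sub>R x) -` N"
    by (auto simp: neighborhood_of_zero_def)
  \<comment> \<open>The closed ball contains its own radius, so \<open>e\<close> itself serves as
    the scalar.\<close>
  then obtain e where e: "e > 0" "cball 0 e \<subseteq> S"
    by (meson open_contains_cball)
  then have "e \<in> S" by (auto simp: subset_iff)
  with S e that show ?thesis by auto
qed

text \<open>Additivity carries the behaviour at zero to any point \<open>a\<close>: near
  \<open>a\<close>, \<open>T\<close> is \<open>T a\<close> plus its values near zero.\<close>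

lemma continuous_map_linear_at_zero:
  assumes vt: "vector_topology \<tau>" and vt': "vector_topology \<tau>'" and "linear T"
    and at0: "\<And>N. neighborhood_of_zero \<tau>' N \<Longrightarrow> neighborhood_of_zero \<tau> (T -` N)"
  shows "continuous_map \<tau> \<tau>' T"
proof -
  have top: "topspace \<tau> = UNIV" "topspace \<tau>' = UNIV"
    using vt vt' by (auto simp: vector_topology_def)
  have "openin \<tau> (T -` W)" if W: "openin \<tau>' W" for W
  proof (subst openin_subopen, intro ballI)
    fix a assume a: "a \<in> T -` W"
    \<comment> \<open>This is \<open>W\<close> shifted by \<open>- T a\<close>; it contains zero
      because \<open>T a \<in> W\<close>, so \<open>at0\<close> applies to it.\<close>
    have "openin \<tau>' {y. T a + y \<in> W}"
      using openin_continuous_map_preimage[OF continuous_map_translation[OF vt', of "T a"] W] top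
      by simp
    with a have "neighborhood_of_zero \<tau>' {y. T a + y \<in> W}"
      by (auto simp: neighborhood_of_zero_def)
    from at0[OF this] obtain U where U: "openin \<tau> U" "0 \<in> U" "U \<subseteq> T -` {y. T a + y \<in> W}"
      by (auto simp: neighborhood_of_zero_def)
    \<comment> \<open>The translate of \<open>U\<close> by \<open>a\<close>, written as a preimage
      so that continuity of translation by \<open>- a\<close> gives openness.\<close>
    have "openin \<tau> {x. - a + x \<in> U}"
      using openin_continuous_map_preimage[OF continuous_map_translation[OF vt, of "- a"] U(1)] top
      by simp
    moreover have "{x. - a + x \<in> U} \<subseteq> T -` W"
    proof
      fix x assume "x \<in> {x. - a + x \<in> U}"
      then have "T a + T (- a + x) \<in> W" using U(3) by auto
      then show "x \<in> T -` W"
        by (simp add: linear_add[OF \<open>linear T\<close>, symmetric])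
    qed
    ultimately show "\<exists>S. openin \<tau> S \<and> a \<in> S \<and> S \<subseteq> T -` W"
      using U(2) by (intro exI[of _ "{x. - a + x \<in> U}"]) auto
  qed
  then show ?thesis
    by (simp add: continuous_map_def top vimage_def)
qed

text \<open>Solidity only sees moduli, so the interval is replaced by one bound for both
  \<open>y\<close> and \<open>- y\<close>: from \<open>y \<le> v\<close> and
  \<open>- y \<le> - u\<close>, the sum \<open>\<bar>u\<bar> + \<bar>v\<bar>\<close> dominates
  each.\<close>

lemma order_bounded_imp_abs_le:
  fixes A :: "'a::riesz_space set"
  assumes "order_bounded A"
  shows "\<exists>w. \<forall>y\<in>A. \<bar>y\<bar> \<le> w"
proof -
  obtain u v where uv: "A \<subseteq> {u..v}"
    using assms by (auto simp: order_bounded_def)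
  have "\<bar>y\<bar> \<le> \<bar>u\<bar> + \<bar>v\<bar>" if "y \<in> A" for y
  proof (rule abs_leI)
    have y: "u \<le> y" "y \<le> v" using that uv by auto
    show "y \<le> \<bar>u\<bar> + \<bar>v\<bar>"
      by (rule add_increasing[OF abs_ge_zero order_trans[OF y(2) abs_ge_self]])
    show "- y \<le> \<bar>u\<bar> + \<bar>v\<bar>"
      by (rule add_increasing2[OF abs_ge_zero order_trans[OF le_imp_neg_le[OF y(1)] abs_ge_minus_self]])
  qed
  then show ?thesis by blast
qed

text \<open>Both \<open>y\<close> and \<open>- y\<close> lie below \<open>w\<close>, and scaling by
  \<open>e \<ge> 0\<close> preserves this. The modulus on the right matches the form that
  \<open>solid\<close> compares.\<close>

lemma abs_scaleR_le_abs:
  fixes y w :: "'a::riesz_space"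
  assumes "\<bar>y\<bar> \<le> w" "0 \<le> e"
  shows "\<bar>e *\<^sub>R y\<bar> \<le> \<bar>e *\<^sub>R w\<bar>"
proof (rule abs_leI)
  have "y \<le> w" "- y \<le> w"
    by (rule order_trans[OF abs_ge_self assms(1)], rule order_trans[OF abs_ge_minus_self assms(1)])
  then have "e *\<^sub>R y \<le> e *\<^sub>R w" "e *\<^sub>R (- y) \<le> e *\<^sub>R w"
    using assms(2) by (blast intro: scaleR_left_mono)+
  then show "e *\<^sub>R y \<le> \<bar>e *\<^sub>R w\<bar>" "- (e *\<^sub>R y) \<le> \<bar>e *\<^sub>R w\<bar>"
    using order_trans[OF _ abs_ge_self[of "e *\<^sub>R w"]] by simp_all
qed

theorem theorem2p4:
  fixes \<tau> :: "'l::riesz_space topology"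
    and \<tau>' :: "'m::riesz_space topology"
    and T :: "'l \<Rightarrow> 'm"
  assumes "locally_solid \<tau>"
    and "locally_solid \<tau>'"
    and "linear T"
    and "positive_homogeneous T"
    and "\<exists>V. neighborhood_of_zero \<tau> V \<and> order_bounded (T ` V)"
  shows "continuous_map \<tau> \<tau>' T"
proof (rule continuous_map_linear_at_zero)
  show vt: "vector_topology \<tau>" and vt': "vector_topology \<tau>'"
    using assms(1,2) by (auto simp: locally_solid_def)
  show "linear T" by fact
  obtain V where V: "neighborhood_of_zero \<tau> V" "order_bounded (T ` V)"
    using assms(5) by blast
  obtain w where w: "\<forall>y\<in>T ` V. \<bar>y\<bar> \<le> w"
    using order_bounded_imp_abs_le[OF V(2)] ..
  fix N assume "neighborhood_of_zero \<tau>' N"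
  then obtain U where U: "neighborhood_of_zero \<tau>' U" "solid U" "U \<subseteq> N"
    using assms(2) unfolding locally_solid_def by blast
  obtain e where e: "e > 0" "e *\<^sub>R w \<in> U"
    using neighborhood_of_zero_absorbs[OF vt' U(1)] .
  \<comment> \<open>This preimage is the dilate of \<open>V\<close> by \<open>e\<close>.\<close>
  have "neighborhood_of_zero \<tau> ((\<lambda>x. inverse e *\<^sub>R x) -` V)"
    using neighborhood_of_zero_vimage[OF continuous_map_scaleR_right[OF vt]] V(1) vt
    by (simp add: vector_topology_def)
  moreover have "(\<lambda>x. inverse e *\<^sub>R x) -` V \<subseteq> T -` N"
  proof
    fix x assume "x \<in> (\<lambda>x. inverse e *\<^sub>R x) -` V"
    then have "\<bar>e *\<^sub>R T (inverse e *\<^sub>R x)\<bar> \<le> \<bar>e *\<^sub>R w\<bar>"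
      using w e(1) by (intro abs_scaleR_le_abs) auto
    \<comment> \<open>Homogeneity cancels the two scalings, so the bound is on \<open>T x\<close>
      itself, and solidity of \<open>U\<close> then puts \<open>T x\<close> in
      \<open>U\<close>.\<close>
    moreover have "e *\<^sub>R T (inverse e *\<^sub>R x) = T x"
      using e(1) by (simp add: linear_scale[OF \<open>linear T\<close>])
    ultimately show "x \<in> T -` N"
      using U(2,3) e(2) unfolding solid_def by auto
  qed
  ultimately show "neighborhood_of_zero \<tau> (T -` N)"
    unfolding neighborhood_of_zero_def by blast
qed

end
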